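(* Let $\mathbf G$ be a uniformly random $d$-regular graph on $n$ vertices and let $\eta\in(0,1/2)$ be a constant. If there is an efficient algorithm that with high probability certifies a bound of $\exp\big(\frac{C_d}{4}\eta\log(1/\eta)n\big)$ on the number of independent sets of size $C_d(1-\eta)n$ in $\mathbf G$, then there is an algorithm that with high probability certifies that $\mathbf G$ has no independent set of size $(1-\eta/2)C_dn$.
   Context: $r_d:=\frac{2\sqrt{d-1}}{d}$ and $C_d:=\frac{r_d}{1+r_d}$. An algorithm certifies a bound $C$ on a quantity $f$ with high probability if it outputs a number $A(G)$ with $f(G)\le A(G)$ for every input graph $G$ and $A(\mathbf G)\le C$ with probability $1-o(1)$; it certifies a statement with high probability if it always outputs success or failure, success implies the statement for the input, and success occurs with probability $1-o(1)$. *)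

theory Defs
  imports "HOL-Probability.Probability" "HOL-Computational_Algebra.Polynomial"
begin

section \<open>Labelled simple graphs\<close>

text \<open>A graph on the vertex set \<open>{..<n}\<close> is given by its set of edges.\<close>

definition graphs :: "nat \<Rightarrow> nat set set set" where
  "graphs n = {E. \<forall>e\<in>E. e \<subseteq> {..<n} \<and> card e = 2}"

definition regular_graphs :: "nat \<Rightarrow> nat \<Rightarrow> nat set set set" where
  "regular_graphs d n = {E \<in> graphs n. \<forall>v<n. card {e \<in> E. v \<in> e} = d}"

definition independent_sets :: "nat \<Rightarrow> nat set set \<Rightarrow> nat \<Rightarrow> nat set set" where
  "independent_sets n E k = {S. S \<subseteq> {..<n} \<and> card S = k \<and> (\<forall>e\<in>E. \<not> e \<subseteq> S)}"

definition r_d :: "nat \<Rightarrow> real" where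
  "r_d d = 2 * sqrt (real d - 1) / real d"

definition C_d :: "nat \<Rightarrow> real" where
  "C_d d = r_d d / (1 + r_d d)"

text \<open>
  With probability \<open>1 - o(1)\<close> over a uniformly random \<open>d\<close>-regular graph on \<open>n\<close> vertices,
  for constant \<open>d\<close>. The limit runs through those \<open>n\<close> for which such graphs exist
  (for odd \<open>d\<close> only even \<open>n\<close> occur); this also keeps \<open>pmf_of_set\<close> meaningful.
\<close>

definition whp_regular :: "nat \<Rightarrow> (nat \<Rightarrow> nat set set \<Rightarrow> bool) \<Rightarrow> bool" where
  "whp_regular d Q \<longleftrightarrow>
     ((\<lambda>n. measure_pmf.prob (pmf_of_set (regular_graphs d n)) {E. Q n E}) \<longlongrightarrow> 1)
       (inf sequentially (principal {n. regular_graphs d n \<noteq> {}}))"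

section \<open>Algorithms\<close>

text \<open>
  An algorithm is a program operating on finitely many stacks of bits, at unit cost per
  instruction or test. Two stacks simulate one tape and conversely, so up to polynomial
  factors in the running time this is the multitape Turing machine model.
  The head of a list is the top of the stack.
\<close>

datatype prog =
    Skip
  | Push nat bool
  | Pop nat
  | Seq prog prog
  | Branch nat prog prog prog  \<comment> \<open>on an empty stack, on top bit 0, on top bit 1\<close>
  | While nat prog  \<comment> \<open>as long as the stack is nonempty\<close>

type_synonym store = "nat \<Rightarrow> bool list"

text \<open>\<open>exec P s t s'\<close>: started in \<open>s\<close>, \<open>P\<close> halts in \<open>s'\<close> after exactly \<open>t\<close> steps.\<close>

inductive exec :: "prog \<Rightarrow> store \<Rightarrow> nat \<Rightarrow> store \<Rightarrow> bool" where
  Skip: "exec Skip s 1 s"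
| Push: "exec (Push i b) s 1 (s(i := b # s i))"
| Pop: "exec (Pop i) s 1 (s(i := tl (s i)))"
| Seq: "exec P s t s' \<Longrightarrow> exec Q s' u s'' \<Longrightarrow> exec (Seq P Q) s (t + u) s''"
| Branch_Empty: "s i = [] \<Longrightarrow> exec P s t s' \<Longrightarrow> exec (Branch i P Q R) s (Suc t) s'"
| Branch_0: "s i = False # xs \<Longrightarrow> exec Q s t s' \<Longrightarrow> exec (Branch i P Q R) s (Suc t) s'"
| Branch_1: "s i = True # xs \<Longrightarrow> exec R s t s' \<Longrightarrow> exec (Branch i P Q R) s (Suc t) s'"
| While_Done: "s i = [] \<Longrightarrow> exec (While i P) s 1 s"
| While_Step: "s i \<noteq> [] \<Longrightarrow> exec P s t s' \<Longrightarrow> exec (While i P) s' u s'' \<Longrightarrow>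
    exec (While i P) s (Suc (t + u)) s''"

lemma exec_deterministic:
  "exec P s t s' \<Longrightarrow> exec P s u s'' \<Longrightarrow> u = t \<and> s'' = s'"
proof (induction arbitrary: u s'' rule: exec.induct)
  case Skip
  then show ?case by (cases rule: exec.cases) simp_all
next
  case Push
  then show ?case by (cases rule: exec.cases) simp_all
next
  case Pop
  then show ?case by (cases rule: exec.cases) simp_all
next
  case Seq
  from Seq.prems show ?case by (cases rule: exec.cases) (metis Seq.IH)
next
  case Branch_Empty
  from Branch_Empty.prems show ?case
    by (cases rule: exec.cases) (simp_all add: Branch_Empty.hyps, metis Branch_Empty.IH)
next
  case Branch_0
  from Branch_0.prems show ?case
    by (cases rule: exec.cases) (simp_all add: Branch_0.hyps, metis Branch_0.IH)
next
  case Branch_1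
  from Branch_1.prems show ?case
    by (cases rule: exec.cases) (simp_all add: Branch_1.hyps, metis Branch_1.IH)
next
  case While_Done
  from While_Done.prems show ?case
    by (cases rule: exec.cases) (simp_all add: While_Done.hyps)
next
  case While_Step
  from While_Step.prems show ?case
    by (cases rule: exec.cases) (simp_all add: While_Step.hyps(1), metis While_Step.IH)
qed

text \<open>The input graph is presented as \<open>n\<close> in unary followed by the adjacency matrix.\<close>

definition encode_graph :: "nat \<Rightarrow> nat set set \<Rightarrow> bool list" where
  "encode_graph n E =
     replicate n True @ False # concat (map (\<lambda>i. map (\<lambda>j. {i, j} \<in> E) [0..<n]) [0..<n])"

definition initial_store :: "nat \<Rightarrow> nat set set \<Rightarrow> store" where
  "initial_store n E = (\<lambda>i. if i = 0 then encode_graph n E else [])"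

definition efficient :: "prog \<Rightarrow> bool" where
  "efficient P \<longleftrightarrow> (\<exists>q :: nat poly. \<forall>n. \<forall>E \<in> graphs n.
     \<exists>t s. exec P (initial_store n E) t s \<and> t \<le> poly q (length (encode_graph n E)))"

text \<open>Binary notation, most significant bit first, leading zeros allowed.\<close>

definition binary_value :: "bool list \<Rightarrow> nat" where
  "binary_value bs = horner_sum of_bool 2 (rev bs)"

text \<open>Numbers are output as fractions, with numerator on stack 0 and denominator on stack 1.\<close>

definition outputs_number :: "prog \<Rightarrow> nat \<Rightarrow> nat set set \<Rightarrow> real \<Rightarrow> bool" where
  "outputs_number P n E a \<longleftrightarrow> (\<exists>t s. exec P (initial_store n E) t s \<and>
     binary_value (s 1) \<noteq> 0 \<and> a = real (binary_value (s 0)) / real (binary_value (s 1)))"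

definition outputs_success :: "prog \<Rightarrow> nat \<Rightarrow> nat set set \<Rightarrow> bool" where
  "outputs_success P n E \<longleftrightarrow> (\<exists>t s. exec P (initial_store n E) t s \<and> s 0 = [True])"

definition outputs_failure :: "prog \<Rightarrow> nat \<Rightarrow> nat set set \<Rightarrow> bool" where
  "outputs_failure P n E \<longleftrightarrow> (\<exists>t s. exec P (initial_store n E) t s \<and> s 0 = [False])"

section \<open>Certification with high probability\<close>

definition certifies_bound_whp ::
    "nat \<Rightarrow> prog \<Rightarrow> (nat \<Rightarrow> nat set set \<Rightarrow> real) \<Rightarrow> (nat \<Rightarrow> real) \<Rightarrow> bool" where
  "certifies_bound_whp d P f C \<longleftrightarrow> (\<exists>A.
     (\<forall>n. \<forall>E \<in> graphs n. outputs_number P n E (A n E) \<and> f n E \<le> A n E) \<and>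
     whp_regular d (\<lambda>n E. A n E \<le> C n))"

definition certifies_whp :: "nat \<Rightarrow> prog \<Rightarrow> (nat \<Rightarrow> nat set set \<Rightarrow> bool) \<Rightarrow> bool" where
  "certifies_whp d P Q \<longleftrightarrow>
     (\<forall>n. \<forall>E \<in> graphs n. outputs_success P n E \<or> outputs_failure P n E) \<and>
     (\<forall>n. \<forall>E \<in> graphs n. outputs_success P n E \<longrightarrow> Q n E) \<and>
     whp_regular d (outputs_success P)"

end

theory Submission
  imports Defs
begin

text \<open>
  An independent set of size \<open>(1 - \<eta>/2) C n\<close> contains
  at least \<open>(1/\<eta>)\<close> to the power \<open>C \<eta> n / 2 - 1\<close> independent sets
  of size \<open>C (1 - \<eta>) n\<close>, which is about the square of the bound certified with high probability.
  This gap leaves room for a rational \<open>\<alpha> = p / q\<close> such that \<open>2\<close> to the power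
  \<open>\<alpha> n\<close> separates the two; no computability of \<open>\<eta>\<close> or \<open>C\<close> is needed, and the
  certified number only has to be known up to a factor of \<open>2\<close>, that is, by its bit lengths.
\<close>

section \<open>Running programs within a time bound\<close>

text \<open>Only an upper bound on the time is kept, so costs can be rounded up whenever programs
  are composed.\<close>

definition runs_within :: "prog \<Rightarrow> store \<Rightarrow> nat \<Rightarrow> store \<Rightarrow> bool" where
  "runs_within P s T s' \<longleftrightarrow> (\<exists>t\<le>T. exec P s t s')"

lemma runs_within_weaken:
  "runs_within P s T s' \<Longrightarrow> T \<le> T' \<Longrightarrow> s' = s'' \<Longrightarrow> runs_within P s T' s''"
  unfolding runs_within_def using le_trans by blast

lemma runs_within_Skip: "runs_within Skip s 1 s"
  unfolding runs_within_def using exec.Skip by blast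

lemma runs_within_Push: "runs_within (Push i b) s 1 (s(i := b # s i))"
  unfolding runs_within_def using exec.Push by blast

lemma runs_within_Pop: "runs_within (Pop i) s 1 (s(i := tl (s i)))"
  unfolding runs_within_def using exec.Pop by blast

lemma runs_within_Seq:
  "runs_within P s T s' \<Longrightarrow> runs_within Q s' U s'' \<Longrightarrow> runs_within (Seq P Q) s (T + U) s''"
  unfolding runs_within_def using exec.Seq add_mono by blast

lemma runs_within_Branch:
  assumes "runs_within (case s i of [] \<Rightarrow> P | b # _ \<Rightarrow> if b then R else Q) s T s'"
  shows "runs_within (Branch i P Q R) s (Suc T) s'"
proof -
  obtain t where t: "t \<le> T" "exec (case s i of [] \<Rightarrow> P | b # _ \<Rightarrow> if b then R else Q) s t s'"
    using assms unfolding runs_within_def by blast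
  have "exec (Branch i P Q R) s (Suc t) s'"
  proof (cases "s i")
    case Nil
    with t show ?thesis by (auto intro: exec.Branch_Empty)
  next
    case (Cons b xs)
    with t show ?thesis by (cases b) (auto intro: exec.Branch_0 exec.Branch_1)
  qed
  with t(1) show ?thesis unfolding runs_within_def by auto
qed

lemma runs_within_While_Done: "s i = [] \<Longrightarrow> runs_within (While i P) s 1 s"
  unfolding runs_within_def using exec.While_Done by blast

lemma runs_within_While_Step:
  assumes "s i \<noteq> []" "runs_within P s T s'" "runs_within (While i P) s' U s''"
  shows "runs_within (While i P) s (Suc (T + U)) s''"
proof -
  obtain t u where "t \<le> T" "exec P s t s'" "u \<le> U" "exec (While i P) s' u s''"
    using assms unfolding runs_within_def by blast
  moreover from this have "exec (While i P) s (Suc (t + u)) s''"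
    using assms(1) by (auto intro: exec.While_Step)
  ultimately show ?thesis
    unfolding runs_within_def by (auto intro!: exI[of _ "Suc (t + u)"])
qed

section \<open>Stack growth and untouched stacks\<close>

text \<open>A step pushes at most one bit. This keeps the output of an efficient program short
  enough to be scanned afterwards in polynomial time.\<close>

lemma exec_length_le: "exec P s t s' \<Longrightarrow> length (s' i) \<le> length (s i) + t"
  by (induction rule: exec.induct) (auto simp: le_diff_conv)

primrec stack_bound :: "prog \<Rightarrow> nat" where
  "stack_bound Skip = 0"
| "stack_bound (Push i b) = Suc i"
| "stack_bound (Pop i) = Suc i"
| "stack_bound (Seq P Q) = max (stack_bound P) (stack_bound Q)"
| "stack_bound (Branch i P Q R) =
    max (Suc i) (max (stack_bound P) (max (stack_bound Q) (stack_bound R)))"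
| "stack_bound (While i P) = max (Suc i) (stack_bound P)"

text \<open>A program neither reads nor writes stacks beyond those it names, so these may hold any
  \<open>z\<close>. This lets a counter survive a run of \<open>P\<close>.\<close>

lemma exec_frame:
  assumes "exec P s t s'" "stack_bound P \<le> k"
  shows "exec P (\<lambda>i. if i < k then s i else z i) t (\<lambda>i. if i < k then s' i else z i)"
  using assms
proof (induction rule: exec.induct)
  case (Skip s)
  show ?case by (rule exec.Skip)
next
  case (Push i b s)
  have "(\<lambda>j. if j < k then (s(i := b # s i)) j else z j) =
      (\<lambda>j. if j < k then s j else z j)(i := b # (if i < k then s i else z i))"
    using Push by (auto simp: fun_eq_iff)
  then show ?case using exec.Push[of i b "\<lambda>j. if j < k then s j else z j"] by simp
next
  case (Pop i s)
  have "(\<lambda>j. if j < k then (s(i := tl (s i))) j else z j) =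
      (\<lambda>j. if j < k then s j else z j)(i := tl (if i < k then s i else z i))"
    using Pop by (auto simp: fun_eq_iff)
  then show ?case using exec.Pop[of i "\<lambda>j. if j < k then s j else z j"] by simp
next
  case Seq
  then show ?case by (auto intro: exec.Seq)
next
  case Branch_Empty
  then show ?case by (auto intro: exec.Branch_Empty)
next
  case Branch_0
  then show ?case by (auto intro: exec.Branch_0)
next
  case Branch_1
  then show ?case by (auto intro: exec.Branch_1)
next
  case While_Done
  then show ?case by (intro exec.While_Done) auto
next
  case While_Step
  then show ?case by (auto intro!: exec.While_Step)
qed

section \<open>Unary arithmetic by loops on stacks\<close>

primrec repeat_prog :: "nat \<Rightarrow> prog \<Rightarrow> prog" where
  "repeat_prog 0 P = Skip"
| "repeat_prog (Suc m) P = Seq P (repeat_prog m P)"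

lemma runs_within_repeat_Pop:
  "runs_within (repeat_prog m (Pop i)) s (Suc m) (s(i := drop m (s i)))"
proof (induction m arbitrary: s)
  case 0
  show ?case using runs_within_Skip by simp
next
  case (Suc m)
  show ?case
    unfolding repeat_prog.simps
    by (rule runs_within_weaken[OF runs_within_Seq[OF runs_within_Pop Suc.IH]])
      (auto simp: drop_Suc)
qed

lemma runs_within_repeat_Push:
  "runs_within (repeat_prog m (Push i b)) s (Suc m) (s(i := replicate m b @ s i))"
proof (induction m arbitrary: s)
  case 0
  show ?case using runs_within_Skip by simp
next
  case (Suc m)
  show ?case
    unfolding repeat_prog.simps
    by (rule runs_within_weaken[OF runs_within_Seq[OF runs_within_Push Suc.IH]])
      (auto simp: replicate_app_Cons_same)
qed

text \<open>\<open>While\<close> tests only for emptiness, whereas the unary prefix ends at a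
  \<open>False\<close> on a nonempty stack. Hence the loop runs on a flag \<open>f\<close>, which is
  popped when that \<open>False\<close> comes to the top; the \<open>False\<close> itself stays.
  Pushing \<open>p\<close> ones per round multiplies by \<open>p\<close>.\<close>

definition move_unary :: "nat \<Rightarrow> nat \<Rightarrow> nat \<Rightarrow> nat \<Rightarrow> prog" where
  "move_unary a u f p = While f (Branch 0 (Pop f) (Pop f)
     (Seq (Pop 0) (Seq (Push a True) (repeat_prog p (Push u True)))))"

lemma runs_within_move_unary:
  assumes "s 0 = replicate n True @ False # xs" "s f = [True]"
    and "distinct [0, a, u, f]"
  shows "runs_within (move_unary a u f p) s (n * (p + 5) + 4)
    (s(0 := False # xs, a := replicate n True @ s a, u := replicate (n * p) True @ s u, f := []))"
  using assms(1,2)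
proof (induction n arbitrary: s)
  case 0
  let ?s = "s(f := [])"
  have 1: "runs_within (Branch 0 (Pop f) (Pop f)
     (Seq (Pop 0) (Seq (Push a True) (repeat_prog p (Push u True))))) s (Suc 1) ?s"
    by (rule runs_within_Branch) (use 0 runs_within_Pop[of f s] in simp)
  have 2: "runs_within (move_unary a u f p) ?s 1 ?s"
    unfolding move_unary_def by (rule runs_within_While_Done) simp
  show ?case
    unfolding move_unary_def
    by (rule runs_within_weaken[OF runs_within_While_Step[OF _ 1 2[unfolded move_unary_def]]])
      (use 0 assms(3) in \<open>auto simp: fun_eq_iff\<close>)
next
  case (Suc n)
  let ?s = "s(0 := tl (s 0), a := True # s a, u := replicate p True @ s u)"
  have "runs_within (Seq (Pop 0) (Seq (Push a True) (repeat_prog p (Push u True)))) s (p + 3) ?s"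
    by (rule runs_within_weaken[OF runs_within_Seq[OF runs_within_Pop
      runs_within_Seq[OF runs_within_Push runs_within_repeat_Push]]])
      (use assms(3) in \<open>auto simp: fun_eq_iff\<close>)
  then have 1: "runs_within (Branch 0 (Pop f) (Pop f)
     (Seq (Pop 0) (Seq (Push a True) (repeat_prog p (Push u True))))) s (Suc (p + 3)) ?s"
    by (intro runs_within_Branch) (use Suc.prems in simp)
  have 2: "runs_within (move_unary a u f p) ?s (n * (p + 5) + 4)
    (?s(0 := False # xs, a := replicate n True @ ?s a, u := replicate (n * p) True @ ?s u, f := []))"
    by (rule Suc.IH) (use Suc.prems assms(3) in auto)
  show ?case
    unfolding move_unary_def
    by (rule runs_within_weaken[OF runs_within_While_Step[OF _ 1 2[unfolded move_unary_def]]])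
      (use Suc.prems assms(3) in
        \<open>auto simp: fun_eq_iff replicate_app_Cons_same replicate_add add.commute[of p]\<close>)
qed

lemma runs_within_restore_unary:
  assumes "s a = replicate n True" "a \<noteq> 0"
  shows "runs_within (While a (Seq (Pop a) (Push 0 True))) s (3 * n + 1)
    (s(0 := replicate n True @ s 0, a := []))"
  using assms(1)
proof (induction n arbitrary: s)
  case 0
  show ?case
    by (rule runs_within_weaken[OF runs_within_While_Done]) (use 0 in auto)
next
  case (Suc n)
  let ?s = "s(a := replicate n True, 0 := True # s 0)"
  have 1: "runs_within (Seq (Pop a) (Push 0 True)) s 2 ?s"
    by (rule runs_within_weaken[OF runs_within_Seq[OF runs_within_Pop runs_within_Push]])
      (use Suc.prems assms(2) in auto)
  have 2: "runs_within (While a (Seq (Pop a) (Push 0 True))) ?s (3 * n + 1)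
    (?s(0 := replicate n True @ ?s 0, a := []))"
    by (rule Suc.IH) (use assms(2) in auto)
  show ?case
    by (rule runs_within_weaken[OF runs_within_While_Step[OF _ 1 2]])
      (use Suc.prems assms(2) in \<open>auto simp: fun_eq_iff replicate_app_Cons_same\<close>)
qed

text \<open>Leading zeros are legal in outputs, so lengths measure logarithms only after stripping.
  The flag again ends the loop on a nonempty stack, namely at the first one.\<close>

definition strip_zeros :: "nat \<Rightarrow> nat \<Rightarrow> prog" where
  "strip_zeros i f = Seq (Push f True) (While f (Branch i (Pop f) (Pop i) (Pop f)))"

lemma runs_within_strip_loop:
  assumes "s f = [True]" "i \<noteq> f"
  shows "runs_within (While f (Branch i (Pop f) (Pop i) (Pop f))) s (3 * length (s i) + 4)
    (s(i := dropWhile Not (s i), f := []))"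
proof -
  have "s i = xs \<Longrightarrow> s f = [True] \<Longrightarrow>
      runs_within (While f (Branch i (Pop f) (Pop i) (Pop f))) s (3 * length xs + 4)
        (s(i := dropWhile Not xs, f := []))" for xs
  proof (induction xs arbitrary: s)
    case Nil
    have 1: "runs_within (Branch i (Pop f) (Pop i) (Pop f)) s (Suc 1) (s(f := []))"
      by (rule runs_within_Branch) (use Nil runs_within_Pop[of f s] in simp)
    show ?case
      by (rule runs_within_weaken[OF runs_within_While_Step[OF _ 1 runs_within_While_Done]])
        (use Nil assms(2) in auto)
  next
    case (Cons b xs)
    show ?case
    proof (cases b)
      case True
      have 1: "runs_within (Branch i (Pop f) (Pop i) (Pop f)) s (Suc 1) (s(f := []))"
        by (rule runs_within_Branch) (use True Cons.prems runs_within_Pop[of f s] in simp)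
      show ?thesis
        by (rule runs_within_weaken[OF runs_within_While_Step[OF _ 1 runs_within_While_Done]])
          (use Cons.prems True assms(2) in auto)
    next
      case False
      have 1: "runs_within (Branch i (Pop f) (Pop i) (Pop f)) s (Suc 1) (s(i := xs))"
        by (rule runs_within_Branch) (use False Cons.prems runs_within_Pop[of i s] in simp)
      show ?thesis
        by (rule runs_within_weaken[OF runs_within_While_Step[OF _ 1 Cons.IH]])
          (use Cons.prems False assms(2) in auto)
    qed
  qed
  then show ?thesis using assms(1) by blast
qed

lemma runs_within_strip_zeros:
  assumes "s f = []" "i \<noteq> f"
  shows "runs_within (strip_zeros i f) s (3 * length (s i) + 5)
    (s(i := dropWhile Not (s i)))"
  unfolding strip_zeros_def
  by (rule runs_within_weaken[OF runs_within_Seq[OF runs_within_Push runs_within_strip_loop]])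
    (use assms in \<open>auto simp: fun_eq_iff\<close>)

text \<open>This is truncated subtraction in unary: \<open>q\<close> times the height of stack
  \<open>i\<close> is taken from the height of stack \<open>j\<close>. With \<open>q = 1\<close> it
  yields a difference of bit lengths.\<close>

lemma runs_within_drain:
  assumes "i \<noteq> j"
  shows "runs_within (While i (Seq (Pop i) (repeat_prog q (Pop j)))) s
    (length (s i) * (q + 3) + 1) (s(i := [], j := drop (q * length (s i)) (s j)))"
proof (induction "length (s i)" arbitrary: s)
  case 0
  show ?case
    by (rule runs_within_weaken[OF runs_within_While_Done]) (use 0 in auto)
next
  case (Suc n)
  let ?s = "s(i := tl (s i), j := drop q (s j))"
  have 1: "runs_within (Seq (Pop i) (repeat_prog q (Pop j))) s (q + 2) ?s"
    by (rule runs_within_weaken[OF runs_within_Seq[OF runs_within_Pop runs_within_repeat_Pop]])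
      (use assms in auto)
  have 2: "runs_within (While i (Seq (Pop i) (repeat_prog q (Pop j)))) ?s
      (length (?s i) * (q + 3) + 1) (?s(i := [], j := drop (q * length (?s i)) (?s j)))"
    by (rule Suc.hyps(1)) (use Suc.hyps(2) assms in auto)
  have len: "length (s i) = Suc n" "length (?s i) = n"
    using Suc.hyps(2) assms by auto
  show ?case
    by (rule runs_within_weaken[OF runs_within_While_Step[OF _ 1 2]], unfold len)
      (use len assms in \<open>auto simp: fun_eq_iff add.commute\<close>)
qed

section \<open>Comparing a fraction with an exponential threshold\<close>

lemma binary_value_less: "binary_value bs < 2 ^ length bs"
  unfolding binary_value_def using horner_sum_of_bool_2_less[of "rev bs"] by simp

lemma binary_value_Nil: "binary_value [] = 0"
  by (simp add: binary_value_def)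

lemma binary_value_Cons: "binary_value (b # bs) = of_bool b * 2 ^ length bs + binary_value bs"
  unfolding binary_value_def by (simp add: horner_sum_append)

lemma binary_value_dropWhile: "binary_value (dropWhile Not bs) = binary_value bs"
  by (induction bs) (auto simp: binary_value_Cons)

text \<open>After stripping, the leading bit is one and alone contributes this power.\<close>

lemma binary_value_ge:
  assumes "dropWhile Not bs \<noteq> []"
  shows "2 ^ (length (dropWhile Not bs) - 1) \<le> binary_value bs"
proof -
  obtain b bs' where "dropWhile Not bs = b # bs'" "b"
    using assms hd_dropWhile[of Not bs] by (cases "dropWhile Not bs") auto
  then show ?thesis
    using binary_value_Cons[of b bs'] binary_value_dropWhile[of bs] by simp
qed

text \<open>A crude binary logarithm of the fraction with numerator \<open>xs\<close> and denominator \<open>ys\<close>.\<close>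

definition bit_excess :: "bool list \<Rightarrow> bool list \<Rightarrow> nat" where
  "bit_excess xs ys = length (dropWhile Not xs) - length (dropWhile Not ys)"

text \<open>With stripped lengths \<open>m\<close> and \<open>k\<close>, the numerator is below
  \<open>2 ^ m\<close> and the denominator at least \<open>2 ^ (k - 1)\<close>. Truncating a
  negative \<open>m - k\<close> to 0 only enlarges the bound.\<close>

lemma fraction_less_bit_excess:
  assumes "binary_value ys \<noteq> 0"
  shows "real (binary_value xs) / real (binary_value ys) < 2 ^ Suc (bit_excess xs ys)"
proof -
  let ?m = "length (dropWhile Not xs)" and ?k = "length (dropWhile Not ys)"
  have ne: "dropWhile Not ys \<noteq> []"
    using assms binary_value_dropWhile[of ys] binary_value_Nil by metis
  then have k: "?k \<ge> 1" by (cases "dropWhile Not ys") auto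
  have "binary_value xs < 2 ^ ?m"
    using binary_value_less[of "dropWhile Not xs"] by (simp add: binary_value_dropWhile)
  also have "(2::nat) ^ ?m \<le> 2 ^ (Suc (bit_excess xs ys) + (?k - 1))"
    using k by (intro power_increasing) (auto simp: bit_excess_def)
  also have "\<dots> = 2 ^ Suc (bit_excess xs ys) * 2 ^ (?k - 1)"
    by (rule power_add)
  also have "\<dots> \<le> 2 ^ Suc (bit_excess xs ys) * binary_value ys"
    using binary_value_ge[OF ne] by (intro mult_left_mono) auto
  finally have "binary_value xs < 2 ^ Suc (bit_excess xs ys) * binary_value ys" .
  then have "real (binary_value xs) < real (2 ^ Suc (bit_excess xs ys) * binary_value ys)"
    by (rule of_nat_less_iff[THEN iffD2])
  then show ?thesis
    using assms by (simp add: divide_less_eq)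
qed

text \<open>Positivity rules out truncation: a tiny fraction also has excess 0, and
  \<open>2 ^ 0\<close> need not be below twice its value.\<close>

lemma bit_excess_less_fraction:
  assumes "binary_value ys \<noteq> 0" "bit_excess xs ys > 0"
  shows "2 ^ bit_excess xs ys < 2 * (real (binary_value xs) / real (binary_value ys))"
proof -
  let ?m = "length (dropWhile Not xs)" and ?k = "length (dropWhile Not ys)"
  have m: "?m = bit_excess xs ys + ?k"
    using assms(2) unfolding bit_excess_def by linarith
  then have ne: "dropWhile Not xs \<noteq> []"
    using assms(2) by (metis add_is_0 less_numeral_extra(3) list.size(3))
  have "2 ^ bit_excess xs ys * binary_value ys < (2::nat) ^ bit_excess xs ys * 2 ^ ?k"
    using binary_value_less[of "dropWhile Not ys"]
    by (intro mult_strict_left_mono) (auto simp: binary_value_dropWhile)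
  also have "\<dots> = 2 ^ Suc (?m - 1)"
    using assms(2) m by (simp add: power_add)
  also have "\<dots> \<le> 2 * binary_value xs"
    using binary_value_ge[OF ne] by simp
  finally have "2 ^ bit_excess xs ys * binary_value ys < 2 * binary_value xs" .
  then have "real (2 ^ bit_excess xs ys * binary_value ys) < real (2 * binary_value xs)"
    by (rule of_nat_less_iff[THEN iffD2])
  then show ?thesis
    using assms(1) by (simp add: less_divide_eq)
qed

text \<open>
  Since \<open>P\<close> destroys the input, \<open>n\<close> is first copied to stacks that \<open>P\<close> does not touch: \<open>a\<close> serves
  to restore stack 0, \<open>u\<close> keeps \<open>p * n - N\<close> ones, and \<open>f\<close> is a loop flag. Discarding \<open>N\<close> ones
  makes the program fail on the finitely many small \<open>n\<close> for which the asymptotic estimates do not hold.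
\<close>

definition threshold_prog :: "prog \<Rightarrow> nat \<Rightarrow> nat \<Rightarrow> nat \<Rightarrow> prog" where
  "threshold_prog P p q N =
    (let a = max 2 (stack_bound P); u = a + 1; f = a + 2 in
     Seq (Push f True) (Seq (move_unary a u f p) (Seq (While a (Seq (Pop a) (Push 0 True)))
     (Seq (repeat_prog N (Pop u)) (Seq P (Seq (strip_zeros 0 f) (Seq (strip_zeros 1 f)
     (Seq (While 1 (Seq (Pop 1) (repeat_prog 1 (Pop 0))))
     (Seq (While 0 (Seq (Pop 0) (repeat_prog q (Pop u))))
     (Branch u (Push 0 False) (Push 0 True) (Push 0 True)))))))))))"

text \<open>For fixed \<open>p\<close>, \<open>q\<close>, \<open>N\<close> every stage after
  \<open>P\<close> is linear in \<open>t\<close> and the input length. With \<open>L\<close> the bit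
  excess, \<open>p * n - N - q * L\<close> ones remain on \<open>u\<close>, and the answer is
  whether any are left.\<close>

lemma runs_within_threshold_prog:
  assumes P: "exec P (initial_store n E) t s"
  shows "\<exists>s'. runs_within (threshold_prog P p q N) (initial_store n E)
      (N + (p + q + 20) * (t + length (encode_graph n E) + 2)) s' \<and>
    s' 0 = [q * bit_excess (s 0) (s 1) + N < p * n]"
proof -
  \<comment> \<open>The maximum with 2 separates the scratch stacks from stacks 0 and 1, where the
    output of \<open>P\<close> is read.\<close>
  define a where "a = max 2 (stack_bound P)"
  define u where "u = a + 1"
  define f where "f = a + 2"
  have stacks: "distinct [0, a, u, f]" "distinct [1, a, u, f]" "stack_bound P \<le> a" "0 < a" "1 < a"
    by (auto simp: a_def u_def f_def)
  define l where "l = length (encode_graph n E)"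
  define z where "z = initial_store n E"
  define ones where "ones = drop N (replicate (n * p) True)"
  obtain xs where xs: "z 0 = replicate n True @ False # xs"
    by (simp add: z_def initial_store_def encode_graph_def)
  have z0: "z j = []" if "j \<noteq> 0" for j
    using that by (simp add: z_def initial_store_def)
  have nl: "n < l"
    by (simp add: l_def encode_graph_def)
  define s1 where "s1 = z(f := [True])"
  have r1: "runs_within (Push f True) z 1 s1"
    using runs_within_Push[of f True z] stacks by (simp add: s1_def z0)
  define s2 where "s2 = z(0 := False # xs, a := replicate n True, u := replicate (n * p) True)"
  have r2: "runs_within (move_unary a u f p) s1 (n * (p + 5) + 4) s2"
    by (rule runs_within_weaken[OF runs_within_move_unary[of s1 n xs f a u p]])
      (use xs z0 stacks in \<open>auto simp: s1_def s2_def fun_eq_iff\<close>)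
  define s3 where "s3 = z(u := replicate (n * p) True)"
  have r3: "runs_within (While a (Seq (Pop a) (Push 0 True))) s2 (3 * n + 1) s3"
    by (rule runs_within_weaken[OF runs_within_restore_unary[of s2 a n]])
      (use xs z0 stacks in \<open>auto simp: s2_def s3_def fun_eq_iff\<close>)
  define s4 where "s4 = z(u := ones)"
  have r4: "runs_within (repeat_prog N (Pop u)) s3 (Suc N) s4"
    by (rule runs_within_weaken[OF runs_within_repeat_Pop])
      (auto simp: s3_def s4_def ones_def fun_eq_iff)
  \<comment> \<open>When \<open>P\<close> starts, the stacks below \<open>a\<close> are exactly as
    in the initial store and only \<open>u\<close> is filled above, so the frame property transfers
    the given run.\<close>
  define s5 where "s5 = (\<lambda>j. if j < a then s j else if j = u then ones else [])"
  have "exec P (\<lambda>j. if j < a then z j else if j = u then ones else []) t s5"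
    using exec_frame[OF P stacks(3), of "\<lambda>j. if j = u then ones else []"]
    by (simp add: s5_def z_def if_distrib cong: if_cong)
  moreover have "(\<lambda>j. if j < a then z j else if j = u then ones else []) = s4"
    using stacks z0 by (auto simp: s4_def fun_eq_iff u_def)
  ultimately have r5: "runs_within P s4 t s5"
    unfolding runs_within_def by auto
  have s5: "s5 0 = s 0" "s5 1 = s 1" "s5 u = ones" "s5 f = []"
    using stacks by (auto simp: s5_def u_def f_def)
  \<comment> \<open>Stack 0 starts with the encoded input, stack 1 starts empty.\<close>
  have len0: "length (s 0) \<le> l + t" and len1: "length (s 1) \<le> t"
    using exec_length_le[OF P, of 0] exec_length_le[OF P, of 1]
    by (auto simp: initial_store_def l_def)
  define x y where "x = dropWhile Not (s 0)" and "y = dropWhile Not (s 1)"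
  have lenx: "length x \<le> l + t" and leny: "length y \<le> t"
    using len0 len1 length_dropWhile_le[of Not "s 0"] length_dropWhile_le[of Not "s 1"]
    by (auto simp: x_def y_def)
  define s6 where "s6 = s5(0 := x)"
  have r6: "runs_within (strip_zeros 0 f) s5 (3 * (l + t) + 5) s6"
    by (rule runs_within_weaken[OF runs_within_strip_zeros])
      (use s5 stacks len0 in \<open>auto simp: s6_def x_def\<close>)
  define s7 where "s7 = s6(1 := y)"
  have r7: "runs_within (strip_zeros 1 f) s6 (3 * t + 5) s7"
    by (rule runs_within_weaken[OF runs_within_strip_zeros])
      (use s5 stacks len1 in \<open>auto simp: s6_def s7_def y_def\<close>)
  define s8 where "s8 = s7(0 := drop (length y) x, 1 := [])"
  have r8: "runs_within (While 1 (Seq (Pop 1) (repeat_prog 1 (Pop 0)))) s7 (4 * t + 1) s8"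
    by (rule runs_within_weaken[OF runs_within_drain])
      (use leny in \<open>auto simp: s6_def s7_def s8_def fun_eq_iff\<close>)
  define L where "L = bit_excess (s 0) (s 1)"
  have L: "L = length (drop (length y) x)"
    by (simp add: L_def bit_excess_def x_def y_def)
  define s9 where "s9 = s8(0 := [], u := drop (q * L) ones)"
  have "L \<le> l + t" using lenx L by simp
  then have "L * (q + 3) + 1 \<le> (l + t) * (q + 3) + 1"
    by simp
  then have r9: "runs_within (While 0 (Seq (Pop 0) (repeat_prog q (Pop u)))) s8
      ((l + t) * (q + 3) + 1) s9"
    by (intro runs_within_weaken[OF runs_within_drain])
      (use stacks s5 in \<open>auto simp: s6_def s7_def s8_def s9_def L fun_eq_iff\<close>)
  define s10 where "s10 = s9(0 := [q * L + N < p * n])"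
  have s9: "s9 0 = []" "s9 u = replicate (n * p - N - q * L) True"
    using stacks by (auto simp: s9_def ones_def)
  have r10: "runs_within (Branch u (Push 0 False) (Push 0 True) (Push 0 True)) s9 (Suc 1) s10"
  proof (rule runs_within_Branch)
    show "runs_within (case s9 u of [] \<Rightarrow> Push 0 False
        | b # _ \<Rightarrow> if b then Push 0 True else Push 0 True) s9 1 s10"
    proof (cases "n * p - N - q * L")
      case 0
      then show ?thesis
        using s9 runs_within_Push[of 0 False s9] by (simp add: s10_def mult.commute)
    next
      case (Suc m)
      then have "q * L + N < p * n" by (simp add: mult.commute)
      then show ?thesis
        using Suc s9 runs_within_Push[of 0 True s9] by (simp add: s10_def)
    qed
  qed
  \<comment> \<open>This bounds the one product involving \<open>n\<close>; the generous constant
    \<open>p + q + 20\<close> then absorbs the costs of all ten stages.\<close>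
  have "n * (p + 5) \<le> l * (p + 5)"
    using nl by simp
  then have "runs_within (threshold_prog P p q N) z (N + (p + q + 20) * (t + l + 2)) s10"
    unfolding threshold_prog_def Let_def a_def[symmetric] u_def[symmetric] f_def[symmetric]
    using nl
    by (intro runs_within_weaken[OF runs_within_Seq[OF r1 runs_within_Seq[OF r2
        runs_within_Seq[OF r3 runs_within_Seq[OF r4 runs_within_Seq[OF r5 runs_within_Seq[OF r6
        runs_within_Seq[OF r7 runs_within_Seq[OF r8 runs_within_Seq[OF r9 r10]]]]]]]]]])
      (simp_all add: algebra_simps)
  moreover have "s10 0 = [q * L + N < p * n]"
    by (simp add: s10_def)
  ultimately show ?thesis
    unfolding z_def l_def L_def by blast
qed

lemma efficient_threshold_prog:
  assumes "efficient P"
  shows "efficient (threshold_prog P p q N)"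
proof -
  obtain r where r: "\<And>n E. E \<in> graphs n \<Longrightarrow>
      \<exists>t s. exec P (initial_store n E) t s \<and> t \<le> poly r (length (encode_graph n E))"
    using assms unfolding efficient_def by blast
  \<comment> \<open>\<open>[:2, 1:]\<close> is the polynomial X + 2, matching the summand
    \<open>length + 2\<close> of the cost bound.\<close>
  define r' where "r' = [:N:] + smult (p + q + 20) (r + [:2, 1:])"
  have "\<exists>t s. exec (threshold_prog P p q N) (initial_store n E) t s \<and>
      t \<le> poly r' (length (encode_graph n E))" if E: "E \<in> graphs n" for n E
  proof -
    obtain t s where t: "exec P (initial_store n E) t s" "t \<le> poly r (length (encode_graph n E))"
      using r[OF E] by blast
    obtain t' s' where t': "exec (threshold_prog P p q N) (initial_store n E) t' s'"
        "t' \<le> N + (p + q + 20) * (t + length (encode_graph n E) + 2)"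
      using runs_within_threshold_prog[OF t(1)] unfolding runs_within_def by blast
    note t'(2)
    also have "N + (p + q + 20) * (t + length (encode_graph n E) + 2) \<le>
        N + (p + q + 20) * (poly r (length (encode_graph n E)) + length (encode_graph n E) + 2)"
      using t(2) by (intro add_left_mono mult_left_mono) auto
    also have "\<dots> = poly r' (length (encode_graph n E))"
      by (simp add: r'_def algebra_simps)
    finally show ?thesis using t'(1) by blast
  qed
  then show ?thesis unfolding efficient_def by blast
qed

text \<open>Here \<open>L\<close> is the bit excess of the output of \<open>P\<close>. Determinism
  of \<open>exec\<close> turns the single known run into an equivalence, so the reduction need not
  look at stores again.\<close>

lemma threshold_prog_outcome:
  assumes "outputs_number P n E A"
  obtains L where
    "outputs_success (threshold_prog P p q N) n E \<longleftrightarrow> q * L + N < p * n"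
    "outputs_success (threshold_prog P p q N) n E \<or> outputs_failure (threshold_prog P p q N) n E"
    "A < 2 ^ Suc L" "L > 0 \<Longrightarrow> 2 ^ L < 2 * A"
proof -
  obtain t s where P: "exec P (initial_store n E) t s" and ne: "binary_value (s 1) \<noteq> 0"
    and A: "A = real (binary_value (s 0)) / real (binary_value (s 1))"
    using assms unfolding outputs_number_def by blast
  define L where "L = bit_excess (s 0) (s 1)"
  obtain t' s' where ex: "exec (threshold_prog P p q N) (initial_store n E) t' s'"
    and s': "s' 0 = [q * L + N < p * n]"
    using runs_within_threshold_prog[OF P] unfolding runs_within_def L_def by blast
  have "outputs_success (threshold_prog P p q N) n E \<longleftrightarrow> s' 0 = [True]"
    unfolding outputs_success_def using ex exec_deterministic by blast
  moreover have "outputs_failure (threshold_prog P p q N) n E \<longleftrightarrow> s' 0 = [False]"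
    unfolding outputs_failure_def using ex exec_deterministic by blast
  ultimately show ?thesis
    using that[of L] fraction_less_bit_excess[OF ne, of "s 0"]
      bit_excess_less_fraction[OF ne, of "s 0"] s'
    unfolding A L_def by auto
qed

section \<open>Subsets of independent sets\<close>

lemma finite_graphs: "finite (graphs n)"
proof (rule finite_subset)
  show "graphs n \<subseteq> Pow (Pow {..<n})" by (auto simp: graphs_def)
qed simp

text \<open>All subsets of an independent set are independent.\<close>

lemma binomial_le_card_independent_sets:
  assumes "independent_sets n E m \<noteq> {}"
  shows "m choose k \<le> card (independent_sets n E k)"
proof -
  obtain S where S: "S \<subseteq> {..<n}" "card S = m" "\<forall>e\<in>E. \<not> e \<subseteq> S"
    using assms unfolding independent_sets_def by blast
  have fin: "finite S" using S(1) finite_subset by blast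
  have "m choose k = card {T. T \<subseteq> S \<and> card T = k}"
    using n_subsets[OF fin] S(2) by simp
  also have "\<dots> \<le> card (independent_sets n E k)"
  proof (rule card_mono)
    show "finite (independent_sets n E k)"
      by (rule finite_subset[of _ "Pow {..<n}"]) (auto simp: independent_sets_def)
    show "{T. T \<subseteq> S \<and> card T = k} \<subseteq> independent_sets n E k"
      using S unfolding independent_sets_def by blast
  qed
  finally show ?thesis .
qed

text \<open>Put \<open>j = m - k\<close>, which is about \<open>c * \<eta> * n / 2\<close>. By
  symmetry the coefficient is \<open>m choose j\<close>, at least \<open>(m / j) ^ j\<close>, and
  \<open>j \<le> \<eta> * m\<close> makes the base at least \<open>1 / \<eta>\<close>. The
  \<open>- 1\<close> in the exponent pays for the floors.\<close>

lemma binomial_floor_lower_bound: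
  fixes c \<eta> :: real
  assumes "0 < \<eta>" "\<eta> < 1" "0 < c"
    and large: "2 * (1 + \<eta>) \<le> c * \<eta> * (1 - \<eta>) * real n"
  defines "m \<equiv> nat \<lfloor>(1 - \<eta> / 2) * c * real n\<rfloor>" and "k \<equiv> nat \<lfloor>c * (1 - \<eta>) * real n\<rfloor>"
  shows "exp ((c / 2 * \<eta> * real n - 1) * ln (1 / \<eta>)) \<le> real (m choose k)"
proof -
  define x where "x = c * real n"
  have x: "x \<ge> 0" using assms by (simp add: x_def)
  have ex: "\<eta> * x \<ge> 0" "(1 - \<eta>) * x \<ge> 0" "(1 - \<eta> / 2) * x \<ge> 0" using x assms by auto
  have m: "real m \<le> x - \<eta> * x / 2" "x - \<eta> * x / 2 < real m + 1"
    and k: "real k \<le> x - \<eta> * x" "x - \<eta> * x < real k + 1"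
    using ex unfolding m_def k_def x_def by (simp_all add: algebra_simps) linarith+
  have "real k < real m + 1" using m k ex by linarith
  then have km: "k \<le> m" by simp
  define j where "j = m - k"
  have j: "real j = real m - real k" using km by (simp add: j_def)
  have jl: "\<eta> * x / 2 - 1 \<le> real j" and ju: "real j \<le> \<eta> * x / 2 + 1"
    using m k j by linarith+
  \<comment> \<open>The hypothesis \<open>large\<close> is what
    \<open>\<eta> * x / 2 + 1 \<le> \<eta> * (x - \<eta> * x / 2 - 1)\<close> becomes after
    clearing: the worst rounding of \<open>j\<close> and \<open>m\<close>.\<close>
  have "2 * (1 + \<eta>) \<le> \<eta> * x - \<eta> * (\<eta> * x)"
    using large by (simp add: x_def algebra_simps)
  moreover have "\<eta> * (x - \<eta> * x / 2 - 1) \<le> \<eta> * real m"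
    using m assms(1) by (intro mult_left_mono) auto
  ultimately have jm: "real j \<le> \<eta> * real m"
    using ju by (simp add: algebra_simps)
  have "exp ((c / 2 * \<eta> * real n - 1) * ln (1 / \<eta>)) \<le> exp (real j * ln (1 / \<eta>))"
    using jl assms(1,2) by (auto simp: x_def mult_ac intro!: mult_right_mono)
  also have "\<dots> = (1 / \<eta>) ^ j"
    using assms(1) by (simp add: exp_of_nat_mult)
  also have "\<dots> \<le> real (m choose j)"
  \<comment> \<open>For \<open>j = 0\<close> the quotient \<open>m / j\<close> is 0 by convention,
    but both ends of the chain are 1.\<close>
  proof (cases "j = 0")
    case False
    have "(1 / \<eta>) ^ j \<le> (real m / real j) ^ j"
      using jm False assms(1) by (intro power_mono) (auto simp: field_simps)
    also have "\<dots> \<le> real (m choose j)"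
      by (rule binomial_ge_n_over_k_pow_k) (simp add: j_def)
    finally show ?thesis .
  qed simp
  also have "m choose j = m choose k"
    unfolding j_def using km by (rule binomial_symmetric[symmetric])
  finally show ?thesis .
qed

lemma C_d_pos: "d \<ge> 2 \<Longrightarrow> C_d d > 0"
proof -
  assume "d \<ge> 2"
  then have "r_d d > 0" by (simp add: r_d_def)
  then show ?thesis by (simp add: C_d_def)
qed

section \<open>The reduction\<close>

theorem theorem8p3:
  fixes d :: nat and \<eta> :: real
  assumes "d \<ge> 2" and "0 < \<eta>" and "\<eta> < 1/2"
    and "\<exists>P. efficient P \<and>
      certifies_bound_whp d P
        (\<lambda>n E. real (card (independent_sets n E (nat \<lfloor>C_d d * (1 - \<eta>) * real n\<rfloor>))))
        (\<lambda>n. exp (C_d d / 4 * \<eta> * ln (1 / \<eta>) * real n))"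
  shows "\<exists>P. efficient P \<and>
      certifies_whp d P
        (\<lambda>n E. independent_sets n E (nat \<lfloor>(1 - \<eta> / 2) * C_d d * real n\<rfloor>) = {})"
proof -
  define k m where "k n = nat \<lfloor>C_d d * (1 - \<eta>) * real n\<rfloor>"
    and "m n = nat \<lfloor>(1 - \<eta> / 2) * C_d d * real n\<rfloor>" for n
  \<comment> \<open>\<open>c\<close> is the certified growth rate; a large independent set forces
    rate \<open>2 * c\<close>.\<close>
  define c where "c = C_d d / 4 * \<eta> * ln (1 / \<eta>)"
  have C: "C_d d > 0" using assms(1) by (rule C_d_pos)
  have ln_pos: "ln (1 / \<eta>) > 0" using assms by simp
  have c: "c > 0" using C ln_pos assms(2) by (simp add: c_def)
  obtain P A where P: "efficient P"
    and out: "\<And>n E. E \<in> graphs n \<Longrightarrow> outputs_number P n E (A n E)"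
    and upper: "\<And>n E. E \<in> graphs n \<Longrightarrow> real (card (independent_sets n E (k n))) \<le> A n E"
    and whp: "whp_regular d (\<lambda>n E. A n E \<le> exp (c * real n))"
    using assms(4) unfolding certifies_bound_whp_def k_def c_def by blast
  \<comment> \<open>In base 2 the window between the rates \<open>c\<close> and \<open>2 * c\<close>
    is divided by \<open>ln 2\<close>. A rational \<open>\<alpha>\<close> in it turns the test of
    \<open>L\<close> against \<open>\<alpha> * n\<close> into the integer test of
    \<open>q * L\<close> against \<open>p * n\<close>.\<close>
  have "c / ln 2 < 2 * c / ln 2" "0 < c / ln 2"
    using c by (simp_all add: field_simps)
  then obtain \<alpha> where \<alpha>: "\<alpha> \<in> \<rat>" "c / ln 2 < \<alpha>" "\<alpha> < 2 * c / ln 2"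
    using Rats_dense_in_real by blast
  then obtain p q :: nat where q: "q > 0" and pq: "\<bar>\<alpha>\<bar> = real p / real q"
    using Rats_abs_nat_div_natE by (metis not_gr_zero)
  have \<alpha>pq: "\<alpha> = real p / real q" and \<alpha>_pos: "\<alpha> > 0"
    using pq \<alpha>(2) \<open>0 < c / ln 2\<close> by auto
  have p: "p > 0" using \<alpha>_pos \<alpha>pq q by (cases p) auto
  have \<alpha>_lower: "c < \<alpha> * ln 2" and \<alpha>_upper: "\<alpha> * ln 2 < 2 * c"
    using \<alpha> by (simp_all add: field_simps)
  have ev1: "\<forall>\<^sub>F n in sequentially. 2 * (1 + \<eta>) \<le> C_d d * \<eta> * (1 - \<eta>) * real n"
  proof -
    have "filterlim (\<lambda>n. C_d d * \<eta> * (1 - \<eta>) * real n) at_top sequentially"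
      using C assms by (intro filterlim_tendsto_pos_mult_at_top[OF tendsto_const]
        filterlim_real_sequentially) auto
    then show ?thesis by (simp add: filterlim_at_top)
  qed
  \<comment> \<open>\<open>ln 2\<close> is the factor 2 lost in \<open>A < 2 ^ Suc L\<close>;
    \<open>ln (1 / \<eta>)\<close> is the loss to the floors.\<close>
  have ev2: "\<forall>\<^sub>F n in sequentially. ln 2 + ln (1 / \<eta>) \<le> (2 * c - \<alpha> * ln 2) * real n"
  proof -
    have "filterlim (\<lambda>n. (2 * c - \<alpha> * ln 2) * real n) at_top sequentially"
      using \<alpha>_upper by (intro filterlim_tendsto_pos_mult_at_top[OF tendsto_const]
        filterlim_real_sequentially) auto
    then show ?thesis by (simp add: filterlim_at_top)
  qed
  obtain N where N: "\<And>n. n \<ge> N \<Longrightarrow> 2 * (1 + \<eta>) \<le> C_d d * \<eta> * (1 - \<eta>) * real n"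
      "\<And>n. n \<ge> N \<Longrightarrow> ln 2 + ln (1 / \<eta>) \<le> (2 * c - \<alpha> * ln 2) * real n"
    using eventually_conj[OF ev1 ev2] unfolding eventually_sequentially by blast
  \<comment> \<open>Discarding \<open>p * N\<close> ones means that success forces
    \<open>N < n\<close>, so both estimates are available then.\<close>
  define Q where "Q = threshold_prog P p q (p * N)"
  have sound: "independent_sets n E (m n) = {}"
    if E: "E \<in> graphs n" and succ: "outputs_success Q n E" for n E
  proof (rule ccontr)
    assume ne: "independent_sets n E (m n) \<noteq> {}"
    obtain L where L: "q * L + p * N < p * n" "A n E < 2 ^ Suc L"
      using threshold_prog_outcome[OF out[OF E]] succ unfolding Q_def by metis
    have "p * N < p * n" using L(1) by linarith
    then have n: "n \<ge> N" by simp
    have "q * L < p * n" using L(1) by linarith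
    then have "real q * real L < real p * real n"
      by (metis of_nat_less_iff of_nat_mult)
    then have La: "real L < \<alpha> * real n"
      using q by (simp add: \<alpha>pq field_simps)
    have "(c * 2 * real n - ln (1 / \<eta>)) = (C_d d / 2 * \<eta> * real n - 1) * ln (1 / \<eta>)"
      by (simp add: c_def algebra_simps)
    then have "exp (c * 2 * real n - ln (1 / \<eta>)) \<le> real (m n choose k n)"
      using binomial_floor_lower_bound[OF _ _ C N(1)[OF n]] assms unfolding m_def k_def by simp
    also have "\<dots> \<le> real (card (independent_sets n E (k n)))"
      using binomial_le_card_independent_sets[OF ne] by simp
    also have "\<dots> < 2 ^ Suc L"
      using upper[OF E] L(2) by linarith
    also have "\<dots> = exp (real (Suc L) * ln 2)"
      by (simp only: exp_of_nat_mult) simp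
    finally have "c * 2 * real n - ln (1 / \<eta>) < real (Suc L) * ln 2"
      by simp
    also have "\<dots> \<le> \<alpha> * real n * ln 2 + ln 2"
      using La by (simp add: algebra_simps)
    finally show False
      using N(2)[OF n] by (simp add: algebra_simps)
  qed
  have complete: "\<forall>\<^sub>F n in sequentially. \<forall>E \<in> graphs n.
      A n E \<le> exp (c * real n) \<longrightarrow> outputs_success Q n E"
  proof -
    have "filterlim (\<lambda>n. (\<alpha> * ln 2 - c) * real n) at_top sequentially"
      using \<alpha>_lower by (intro filterlim_tendsto_pos_mult_at_top[OF tendsto_const]
        filterlim_real_sequentially) auto
    \<comment> \<open>The linear gap eventually beats both constant losses: \<open>ln 2\<close> from
      the crude logarithm and \<open>\<alpha> * N * ln 2\<close> from the discarded ones.\<close>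
    then have "\<forall>\<^sub>F n in sequentially. ln 2 + \<alpha> * real N * ln 2 < (\<alpha> * ln 2 - c) * real n"
      by (simp add: filterlim_at_top_dense)
    then show ?thesis
    proof eventually_elim
      case (elim n)
      show ?case
      proof (intro ballI impI)
        fix E assume E: "E \<in> graphs n" and le: "A n E \<le> exp (c * real n)"
        obtain L where L: "outputs_success Q n E \<longleftrightarrow> q * L + p * N < p * n"
            "L > 0 \<Longrightarrow> 2 ^ L < 2 * A n E"
          using threshold_prog_outcome[OF out[OF E]] unfolding Q_def by metis
        have "real L * ln 2 \<le> ln 2 + c * real n"
        \<comment> \<open>The lower bound on \<open>A\<close> holds only for positive excess; for
          \<open>L = 0\<close> the claim is immediate.\<close>
        proof (cases "L = 0")
          case True
          then show ?thesis using c by simp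
        next
          case False
          have "exp (real L * ln 2) = 2 ^ L"
            by (simp only: exp_of_nat_mult) simp
          also have "\<dots> < 2 * exp (c * real n)"
            using L(2) False le by linarith
          also have "\<dots> = exp (ln 2 + c * real n)"
            by (simp add: exp_add)
          finally show ?thesis by simp
        qed
        then have "(real L + \<alpha> * real N) * ln 2 < \<alpha> * real n * ln 2"
          using elim by (simp add: algebra_simps)
        then have "real L + \<alpha> * real N < \<alpha> * real n"
          by (simp add: mult_less_cancel_right)
        then have "real q * (real L + \<alpha> * real N) < real q * (\<alpha> * real n)"
          using q by (intro mult_strict_left_mono) auto
        moreover have "real q * \<alpha> = real p"
          using q by (simp add: \<alpha>pq)
        ultimately have "real (q * L + p * N) < real (p * n)"
          by (simp add: distrib_left flip: mult.assoc)
        then show "outputs_success Q n E"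
          unfolding L(1) by (rule of_nat_less_iff[THEN iffD1])
      qed
    qed
  qed
  have "whp_regular d (outputs_success Q)"
    unfolding whp_regular_def
  \<comment> \<open>The success probability lies between that of the certified bound, which tends to
    1, and 1.\<close>
  proof (rule tendsto_sandwich[OF _ _ whp[unfolded whp_regular_def] tendsto_const])
    show "\<forall>\<^sub>F n in inf sequentially (principal {n. regular_graphs d n \<noteq> {}}).
      measure_pmf.prob (pmf_of_set (regular_graphs d n)) {E. A n E \<le> exp (c * real n)} \<le>
      measure_pmf.prob (pmf_of_set (regular_graphs d n)) {E. outputs_success Q n E}"
      unfolding eventually_inf_principal using complete
    proof eventually_elim
      case (elim n)
      show ?case
      proof
        assume "n \<in> {n. regular_graphs d n \<noteq> {}}"
        moreover have "finite (regular_graphs d n)"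
          using finite_graphs by (rule rev_finite_subset) (auto simp: regular_graphs_def)
        \<comment> \<open>\<open>complete\<close> speaks only of members of \<open>graphs n\<close>,
          so the two events are compared on the support, which is contained there because the set of
          regular graphs is finite and nonempty.\<close>
        ultimately have "set_pmf (pmf_of_set (regular_graphs d n)) \<subseteq> graphs n"
          by (auto simp: regular_graphs_def)
        then have "AE E in measure_pmf (pmf_of_set (regular_graphs d n)).
            E \<in> {E. A n E \<le> exp (c * real n)} \<longrightarrow> E \<in> {E. outputs_success Q n E}"
          using elim by (auto simp: AE_measure_pmf_iff)
        then show "measure_pmf.prob (pmf_of_set (regular_graphs d n)) {E. A n E \<le> exp (c * real n)} \<le>
            measure_pmf.prob (pmf_of_set (regular_graphs d n)) {E. outputs_success Q n E}"
          by (intro measure_pmf.finite_measure_mono_AE) auto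
      qed
    qed
  qed auto
  moreover have "outputs_success Q n E \<or> outputs_failure Q n E" if "E \<in> graphs n" for n E
    using threshold_prog_outcome[OF out[OF that]] unfolding Q_def by metis
  ultimately have "certifies_whp d Q (\<lambda>n E. independent_sets n E (m n) = {})"
    using sound unfolding certifies_whp_def by blast
  then show ?thesis
    using efficient_threshold_prog[OF P] unfolding Q_def m_def by blast
qed

end
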